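(* Consider a balanced DHV network, with $m_1+m_4=m_2+m_5=m_3+m_6=1$, satisfying the nominal-load conditions $\rho_1=\rho_2=\rho_3=\alpha_1<1$. Then, for any ratio matrix $\Delta$, the Skorohod problem (with data $R_\Delta=(CMQ\Delta)^{-1}$, $\theta_\Delta=R_\Delta(\rho-e)$) is stable.
   Context: DHV network: $J=3$ stations, $K=6$ classes. Jobs arrive exogenously only to class $1$, at rate $\alpha_1\ge 0$, and follow the deterministic route $1\to2\to3\to4\to5\to6\to$ exit (so $P_{k,k+1}=1$ for $k=1,\dots,5$, all other $P_{kl}=0$, $\alpha=(\alpha_1,0,\dots,0)'$). Station 1 serves classes $1,4$; station 2 serves $2,5$; station 3 serves $3,6$. $m_k>0$ is the mean service time of class $k$, $M=\mathrm{diag}(m_1,\dots,m_6)$, $C$ is the $3\times6$ matrix with $C_{jk}=1$ if class $k$ is served at station $j$ and $0$ otherwise, $Q=(I-P')^{-1}$, $\rho=CMQ\alpha$, $e$ is the all-ones vector. The network is balanced if all $\rho_j$ are equal; time is normalized so that the common value of $m_1+m_4$, $m_2+m_5$, $m_3+m_6$ is $1$. A ratio matrix is a nonnegative $K\times J$ matrix $\Delta$ with $\Delta_{kj}=0$ if class $k$ is not served at station $j$, and $CM\Delta=I$. Skorohod problem with data $(R,\theta)$: given $\bar W(0)\ge0$, a pair of continuous functions $(\bar Y,\bar W)$ is a solution if $\bar W(t)=\bar W(0)+\theta t+R\bar Y(t)\ge0$, $\bar Y(0)=0$, $\bar Y$ is nondecreasing, and $\int_0^\infty\bar W_j(t)\,d\bar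 Y_j(t)=0$ for all $j$. It is stable if for every solution there is $T<\infty$ with $\bar W(t)=0$ for all $t\ge T$. (Part of the assertion is that $CMQ\Delta$ is invertible, so that $R_\Delta$ is defined.) *)

theory Defs
  imports "HOL-Analysis.Analysis"
begin

text \<open>
  Classes are indexed by \<open>'k\<close> and stations by \<open>'j\<close>.  In \<^typ>\<open>real ^ 'n ^ 'm\<close> the outer index
  \<open>'m\<close> is the row, so a \<open>K \<times> J\<close> matrix has type \<^typ>\<open>real ^ 'j ^ 'k\<close>.  The inverses taken by
  \<^const>\<open>matrix_inv\<close> below are meaningful only for invertible arguments; \<open>I - P'\<close> is invertible
  whenever \<open>P\<close> is nilpotent, as for a deterministic route.
\<close>

definition service_matrix :: "real ^ 'k \<Rightarrow> real ^ 'k ^ 'k" where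
  "service_matrix m = (\<chi> k l. if k = l then m $ k else 0)"

definition visit_matrix :: "real ^ 'k ^ 'k \<Rightarrow> real ^ 'k ^ 'k" where
  "visit_matrix P = matrix_inv (mat 1 - transpose P)"

definition station_load ::
  "real ^ 'k ^ 'j \<Rightarrow> real ^ 'k \<Rightarrow> real ^ 'k ^ 'k \<Rightarrow> real ^ 'k \<Rightarrow> real ^ 'j" where
  "station_load C m P \<alpha> = (C ** service_matrix m ** visit_matrix P) *v \<alpha>"

definition balanced :: "real ^ 'j \<Rightarrow> bool" where
  "balanced \<rho> \<longleftrightarrow> (\<forall>i j. \<rho> $ i = \<rho> $ j)"

definition ratio_matrix :: "real ^ 'k ^ 'j \<Rightarrow> real ^ 'k \<Rightarrow> real ^ 'j ^ 'k \<Rightarrow> bool" where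
  "ratio_matrix C m \<Delta> \<longleftrightarrow>
     (\<forall>k j. \<Delta> $ k $ j \<ge> 0) \<and>
     (\<forall>k j. C $ j $ k = 0 \<longrightarrow> \<Delta> $ k $ j = 0) \<and>
     C ** service_matrix m ** \<Delta> = mat 1"

definition workload_matrix ::
  "real ^ 'k ^ 'j \<Rightarrow> real ^ 'k \<Rightarrow> real ^ 'k ^ 'k \<Rightarrow> real ^ 'j ^ 'k \<Rightarrow> real ^ 'j ^ 'j" where
  "workload_matrix C m P \<Delta> = C ** service_matrix m ** visit_matrix P ** \<Delta>"

definition reflection_matrix ::
  "real ^ 'k ^ 'j \<Rightarrow> real ^ 'k \<Rightarrow> real ^ 'k ^ 'k \<Rightarrow> real ^ 'j ^ 'k \<Rightarrow> real ^ 'j ^ 'j" where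
  "reflection_matrix C m P \<Delta> = matrix_inv (workload_matrix C m P \<Delta>)"

definition drift_vector ::
  "real ^ 'k ^ 'j \<Rightarrow> real ^ 'k \<Rightarrow> real ^ 'k ^ 'k \<Rightarrow> real ^ 'k \<Rightarrow> real ^ 'j ^ 'k \<Rightarrow> real ^ 'j" where
  "drift_vector C m P \<alpha> \<Delta> =
     reflection_matrix C m P \<Delta> *v (station_load C m P \<alpha> - (\<chi> j. 1))"

text \<open>
  The functions live on \<open>[0, \<infinity>)\<close>; their values at negative times are irrelevant.  The orders on
  vectors are componentwise.  Precomposing with \<open>max 0\<close> extends \<open>Y\<^sub>j\<close> by \<open>Y\<^sub>j 0 = 0\<close> to a continuous
  nondecreasing function on all of \<open>\<real>\<close>, as \<^const>\<open>interval_measure\<close> requires, so that the last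
  clause is the Lebesgue-Stieltjes condition \<open>\<integral>\<^sub>0\<^sup>\<infinity> W\<^sub>j(t) dY\<^sub>j(t) = 0\<close>.  The nonnegative integral is
  used because the Bochner integral of a non-integrable function would also be \<open>0\<close>.
\<close>

definition skorohod_solution ::
  "real ^ 'j ^ 'j \<Rightarrow> real ^ 'j \<Rightarrow> (real \<Rightarrow> real ^ 'j) \<Rightarrow> (real \<Rightarrow> real ^ 'j) \<Rightarrow> bool" where
  "skorohod_solution R \<theta> Y W \<longleftrightarrow>
     continuous_on {0..} Y \<and> continuous_on {0..} W \<and>
     (\<forall>t\<ge>0. W t = W 0 + t *\<^sub>R \<theta> + R *v Y t \<and> W t \<ge> 0) \<and>
     Y 0 = 0 \<and> mono_on {0..} Y \<and>
     (\<forall>j. (\<integral>\<^sup>+ t \<in> {0..}. ennreal (W t $ j) \<partial>interval_measure (\<lambda>t. Y (max 0 t) $ j)) = 0)"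

definition skorohod_stable :: "real ^ 'j ^ 'j \<Rightarrow> real ^ 'j \<Rightarrow> bool" where
  "skorohod_stable R \<theta> \<longleftrightarrow>
     (\<forall>Y W. skorohod_solution R \<theta> Y W \<longrightarrow> (\<exists>T\<ge>0. \<forall>t\<ge>T. W t = 0))"

text \<open>
  Numerals of the index types \<open>3\<close> and \<open>6\<close> are taken modulo \<open>3\<close> and \<open>6\<close>, so the last station and
  the last class are \<open>3 = 0\<close> and \<open>6 = 0\<close>.
\<close>

definition dhv_routing :: "real ^ 6 ^ 6" where
  "dhv_routing = (\<chi> k l. if k \<noteq> 6 \<and> l = k + 1 then 1 else 0)"

definition dhv_constituency :: "real ^ 6 ^ 3" where
  "dhv_constituency =
     (\<chi> j k. if (j, k) \<in> {(1, 1), (1, 4), (2, 2), (2, 5), (3, 3), (3, 6)} then 1 else 0)"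

definition dhv_arrival :: "real \<Rightarrow> real ^ 6" where
  "dhv_arrival \<alpha>\<^sub>1 = (\<chi> k. if k = 1 then \<alpha>\<^sub>1 else 0)"

abbreviation "dhv_load m \<alpha>\<^sub>1 \<equiv> station_load dhv_constituency m dhv_routing (dhv_arrival \<alpha>\<^sub>1)"

abbreviation "dhv_ratio_matrix m \<Delta> \<equiv> ratio_matrix dhv_constituency m \<Delta>"

abbreviation "dhv_workload_matrix m \<Delta> \<equiv> workload_matrix dhv_constituency m dhv_routing \<Delta>"

abbreviation "dhv_reflection m \<Delta> \<equiv> reflection_matrix dhv_constituency m dhv_routing \<Delta>"

abbreviation "dhv_drift m \<alpha>\<^sub>1 \<Delta> \<equiv> drift_vector dhv_constituency m dhv_routing (dhv_arrival \<alpha>\<^sub>1) \<Delta>"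

end

(*
  Let G = CMQ Delta and U = G W.  Since G R = I, the process U(t) = U(0) - (1 - alpha_1) t e + Y(t)
  has drift and regulator decoupled.  The function f = max_i L_i . U, for suitable vectors L_1, L_2,
  L_3 with positive coordinate sums, then decreases at a positive rate while W is nonzero, provided
  that on each face W_j = 0 every i with L_ij > 0 is non-maximal: near a maximal i, only those Y_j
  can grow that enter L_i . U with a nonpositive coefficient.  As f > 0 for nonzero W >= 0, the
  process W reaches 0 and stays there.

  Explicitly, column j of G is a nonnegative combination of two vectors determined by m_4, m_5, m_6.
  If m_4 <= m_5, a positive diagonal L works.  If m_5 < m_4, the second row of L is
  replaced by U_2 / 2 + p (U_2 - s U_1), where s is chosen such that U_2 - s U_1 does not involve W_1.
*)
theory Submission imports Defs begin

section \<open>A Lyapunov criterion for stability of Skorohod problems\<close>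

text \<open>The vanishing complementarity integral dominates \<open>e\<close> times the measure of
  \<open>{a<..b}\<close>, and that measure is the increment of the \<open>j\<close>-th regulator
  over the interval.\<close>

lemma skorohod_regulator_flat:
  fixes Y W :: "real \<Rightarrow> real ^ 'j::finite"
  assumes sol: "skorohod_solution R \<theta> Y W"
    and ab: "0 \<le> a" "a \<le> b" and e: "e > 0"
    and W: "\<And>s. \<lbrakk>a \<le> s; s \<le> b\<rbrakk> \<Longrightarrow> e \<le> W s $ j"
  shows "Y b $ j = Y a $ j"
proof -
  define y where "y = (\<lambda>t. Y (max 0 t) $ j)"
  define M where "M = interval_measure y"
  have contY: "continuous_on {0..} Y" and monoY: "mono_on {0..} Y"
    and int0: "(\<integral>\<^sup>+ t \<in> {0..}. ennreal (W t $ j) \<partial>M) = 0"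
    using sol by (auto simp: skorohod_solution_def M_def y_def)
  have mono: "y s \<le> y t" if "s \<le> t" for s t
    using mono_onD[OF monoY, of "max 0 s" "max 0 t"] that
    by (auto simp: y_def less_eq_vec_def)
  have "continuous_on UNIV y"
    unfolding y_def
    by (intro continuous_intros continuous_on_compose2[OF contY]) auto
  then have rc: "continuous (at_right t) y" for t
    by (simp add: continuous_on_eq_continuous_at continuous_at_imp_continuous_at_within)
  have em: "emeasure M {a<..b} = ennreal (y b - y a)"
    unfolding M_def using mono rc ab by (intro emeasure_interval_measure_Ioc) auto
  have "ennreal e * emeasure M {a<..b} = (\<integral>\<^sup>+ t. ennreal e * indicator {a<..b} t \<partial>M)"
    by (simp add: nn_integral_cmult_indicator M_def)
  also have "\<dots> \<le> (\<integral>\<^sup>+ t \<in> {0..}. ennreal (W t $ j) \<partial>M)"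
    using W ab by (intro nn_integral_mono) (auto simp: indicator_def ennreal_leI)
  finally have "emeasure M {a<..b} = 0"
    using int0 e by simp
  then show ?thesis
    using mono[OF \<open>a \<le> b\<close>] ab em by (simp add: y_def ennreal_eq_0_iff)
qed

text \<open>Paths are merely continuous, so the decrease of the maximum is obtained without
  derivatives: it is shown on short intervals around each time and then patched together.\<close>

lemma skorohod_stable_if_piecewise_linear_lyapunov:
  fixes G R :: "real ^ 'j ^ 'j" and \<theta> :: "real ^ 'j" and L :: "'i::finite \<Rightarrow> real ^ 'j"
  assumes GR: "G ** R = mat 1" and d: "d > 0"
    and drift: "\<And>i. L i \<bullet> (G *v \<theta>) \<le> - d"
    and pos: "\<And>w. \<lbrakk>w \<ge> 0; w \<noteq> 0\<rbrakk> \<Longrightarrow> \<exists>i. L i \<bullet> (G *v w) > 0"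
    and face: "\<And>w i j. \<lbrakk>w \<ge> 0; w \<noteq> 0; w $ j = 0; L i $ j > 0\<rbrakk>
      \<Longrightarrow> \<exists>l. L i \<bullet> (G *v w) < L l \<bullet> (G *v w)"
  shows "skorohod_stable R \<theta>"
  unfolding skorohod_stable_def
proof (intro allI impI)
  fix Y W assume sol: "skorohod_solution R \<theta> Y W"
  define V where "V = (\<lambda>i t. L i \<bullet> (G *v W t))"
  define F where "F = (\<lambda>t. Max (range (\<lambda>i. V i t)))"
  have contW: "continuous_on {0..} W" and monoY: "mono_on {0..} Y"
    and eqW: "\<And>t. t \<ge> 0 \<Longrightarrow> W t = W 0 + t *\<^sub>R \<theta> + R *v Y t"
    and W0: "\<And>t. t \<ge> 0 \<Longrightarrow> W t \<ge> 0"
    using sol unfolding skorohod_solution_def by blast+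
  have GRv: "G *v (R *v y) = y" for y
    by (simp add: matrix_vector_mul_assoc GR)
  have V_eq: "V i t = V i 0 + t * (L i \<bullet> (G *v \<theta>)) + L i \<bullet> Y t" if "t \<ge> 0" for i t
  proof -
    have "G *v W t = G *v W 0 + t *\<^sub>R (G *v \<theta>) + Y t"
      by (subst eqW[OF that])
        (simp add: matrix_vector_right_distrib GRv matrix_vector_mult_scaleR)
    then show ?thesis by (simp add: V_def inner_add_right)
  qed
  have contV: "continuous_on {0..} (V i)" for i
    unfolding V_def
    by (intro continuous_intros contW linear_continuous_on_compose[OF contW])
       (auto simp: matrix_vector_mul_linear)
  have F_ge: "V i t \<le> F t" for i t by (simp add: F_def)
  have F_attained: "\<exists>i. F t = V i t" for t
  proof -
    have "F t \<in> range (\<lambda>i. V i t)" unfolding F_def by (intro Max_in) auto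
    then show ?thesis by auto
  qed
  \<comment> \<open>At times with \<open>W = 0\<close> the function \<open>F\<close> is zero, its
    least value; the floor \<open>\<epsilon>\<close> absorbs a neighbourhood of these times.\<close>
  have step: "F b \<le> max \<epsilon> (F a - d * (b - a))" if ab: "0 \<le> a" "a \<le> b" and \<epsilon>: "\<epsilon> > 0" for a b \<epsilon>
  proof -
    \<comment> \<open>Bisection: the bound must survive concatenation and hold on all short
      intervals around each point. The premise \<open>0 \<le> a\<close> stays inside the predicate
      because such intervals may begin at negative times.\<close>
    have "0 \<le> a \<longrightarrow> F b \<le> max \<epsilon> (F a - d * (b - a))"
    proof (rule Bolzano[OF \<open>a \<le> b\<close>, where P = "\<lambda>a b. 0 \<le> a \<longrightarrow> F b \<le> max \<epsilon> (F a - d * (b - a))"])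
    fix p q r :: real
    assume "0 \<le> p \<longrightarrow> F q \<le> max \<epsilon> (F p - d * (q - p))" "0 \<le> q \<longrightarrow> F r \<le> max \<epsilon> (F q - d * (r - q))"
      "p \<le> q" "q \<le> r"
    moreover have "d * (r - q) \<ge> 0" using d \<open>q \<le> r\<close> by simp
    ultimately show "0 \<le> p \<longrightarrow> F r \<le> max \<epsilon> (F p - d * (r - p))"
      by (auto simp: max_def algebra_simps split: if_splits)
  next
    fix x assume "a \<le> x" "x \<le> b"
    then have x: "x \<ge> 0" using ab by simp
    let ?E = "at x within {0..}"
    have limV: "(V i \<longlongrightarrow> V i x) ?E" for i
      using contV[of i] x by (auto simp: continuous_on_def)
    have limW: "((\<lambda>s. W s $ j) \<longlongrightarrow> W x $ j) ?E" for j
      using contW x by (auto simp: continuous_on_def intro: tendsto_vec_nth)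
    show "\<exists>\<delta>>0. \<forall>p q. p \<le> x \<and> x \<le> q \<and> q - p < \<delta> \<longrightarrow> 0 \<le> p \<longrightarrow> F q \<le> max \<epsilon> (F p - d * (q - p))"
    proof (cases "W x = 0")
      case True
      have "\<forall>\<^sub>F s in ?E. \<forall>i. V i s < \<epsilon>"
        using limV \<epsilon> True by (intro eventually_all_finite order_tendstoD) (simp add: V_def)
      then obtain \<delta> where "\<delta> > 0"
        and \<delta>: "\<And>s i. \<lbrakk>s \<ge> 0; s \<noteq> x; dist s x < \<delta>\<rbrakk> \<Longrightarrow> V i s < \<epsilon>"
        by (auto simp: eventually_at)
      have "V i s < \<epsilon>" if "s \<ge> 0" "\<bar>s - x\<bar> < \<delta>" for s i
        using \<delta>[of s i] that True \<epsilon> by (cases "s = x") (auto simp: V_def dist_real_def)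
      then have "F s < \<epsilon>" if "s \<ge> 0" "\<bar>s - x\<bar> < \<delta>" for s
        using F_attained[of s] that by metis
      then show ?thesis
        using \<open>\<delta> > 0\<close> by (intro exI[of _ \<delta>]) (auto simp: le_max_iff_disj less_imp_le)
    next
      case False
      obtain l where l: "F x = V l x" using F_attained by blast
      have "\<forall>\<^sub>F s in ?E. V i x < V l x \<longrightarrow> V i s < V l s" for i
      proof (cases "V i x < V l x")
        case True
        have "((\<lambda>s. V l s - V i s) \<longlongrightarrow> V l x - V i x) ?E"
          using limV by (intro tendsto_diff)
        then have "\<forall>\<^sub>F s in ?E. 0 < V l s - V i s"
          using True by (intro order_tendstoD) auto
        then show ?thesis by eventually_elim simp
      qed simp
      moreover have "\<forall>\<^sub>F s in ?E. W x $ j > 0 \<longrightarrow> W s $ j > W x $ j / 2" for j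
      proof (cases "W x $ j > 0")
        case True
        then have "\<forall>\<^sub>F s in ?E. W s $ j > W x $ j / 2"
          using limW by (intro order_tendstoD) auto
        then show ?thesis by eventually_elim simp
      qed simp
      ultimately have "\<forall>\<^sub>F s in ?E. (\<forall>i. V i x < V l x \<longrightarrow> V i s < V l s) \<and>
          (\<forall>j. W x $ j > 0 \<longrightarrow> W s $ j > W x $ j / 2)"
        by (intro eventually_conj eventually_all_finite)
      then obtain \<delta> where "\<delta> > 0" and \<delta>0: "\<And>s. \<lbrakk>s \<ge> 0; s \<noteq> x; dist s x < \<delta>\<rbrakk> \<Longrightarrow>
          (\<forall>i. V i x < V l x \<longrightarrow> V i s < V l s) \<and> (\<forall>j. W x $ j > 0 \<longrightarrow> W s $ j > W x $ j / 2)"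
        by (auto simp: eventually_at)
      then have \<delta>: "(\<forall>i. V i x < V l x \<longrightarrow> V i s < V l s) \<and>
          (\<forall>j. W x $ j > 0 \<longrightarrow> W s $ j > W x $ j / 2)" if "s \<ge> 0" "\<bar>s - x\<bar> < \<delta>" for s
        using that by (cases "s = x") (auto simp: dist_real_def)
      have "F q \<le> F p - d * (q - p)" if pq: "p \<le> x" "x \<le> q" "q - p < \<delta>" "0 \<le> p" for p q
      proof -
        \<comment> \<open>An index maximal at the right end suffices, since
          \<open>V i p \<le> F p\<close>. By the choice of \<open>\<delta>\<close> it is maximal at
          \<open>x\<close> too, where \<open>face\<close> applies.\<close>
        obtain i where i: "F q = V i q" using F_attained by blast
        have max: "V i x = F x"
        proof (rule ccontr)
          assume "V i x \<noteq> F x"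
          then have "V i x < V l x" using F_ge[of i x] l by simp
          then have "V i q < V l q" using \<delta>[of q] pq by auto
          then show False using i F_ge[of l q] by simp
        qed
        have "L i $ j * (Y q $ j - Y p $ j) \<le> 0" for j
        proof (cases "L i $ j > 0")
          case True
          have "W x $ j \<noteq> 0"
            using face[OF W0[OF x] False _ True] max F_ge by (fastforce simp: V_def not_le[symmetric])
          moreover have "W x $ j \<ge> 0" using W0[OF x] by (simp add: less_eq_vec_def)
          ultimately have Wx: "W x $ j > 0" by simp
          then have "W x $ j / 2 \<le> W s $ j" if "p \<le> s" "s \<le> q" for s
            using \<delta>[of s] that pq by (auto intro!: less_imp_le)
          then have "Y q $ j = Y p $ j"
            using pq Wx by (intro skorohod_regulator_flat[OF sol, where e = "W x $ j / 2"]) auto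
          then show ?thesis by simp
        next
          case False
          moreover have "Y p $ j \<le> Y q $ j"
            using mono_onD[OF monoY, of p q] pq by (auto simp: less_eq_vec_def)
          ultimately show ?thesis by (simp add: mult_nonpos_nonneg)
        qed
        then have "L i \<bullet> (Y q - Y p) \<le> 0"
          by (auto simp: inner_vec_def intro!: sum_nonpos)
        moreover have "(q - p) * (L i \<bullet> (G *v \<theta>)) \<le> (q - p) * (- d)"
          using drift[of i] pq by (intro mult_left_mono) auto
        ultimately have "V i q \<le> V i p - d * (q - p)"
          using V_eq[of q i] V_eq[of p i] pq by (simp add: inner_diff_right algebra_simps)
        then show ?thesis using i F_ge[of i p] by simp
      qed
      then show ?thesis
        using \<open>\<delta> > 0\<close> by (intro exI[of _ \<delta>]) (auto simp: le_max_iff_disj)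
    qed
    qed
    then show ?thesis using ab by simp
  qed
  have "W t = 0" if t: "t \<ge> max 0 (F 0 / d)" for t
  proof (rule ccontr)
    assume "W t \<noteq> 0"
    then obtain i where "V i t > 0" using pos[OF W0, of t] t by (auto simp: V_def)
    then have "F t > 0" using F_ge[of i t] by simp
    moreover have "F 0 - d * t \<le> 0" using t d by (simp add: field_simps)
    \<comment> \<open>With \<open>F t / 2\<close> as the floor, only the second argument of the
      maximum can bound \<open>F t\<close>, and it is at most 0.\<close>
    moreover have "F t \<le> max (F t / 2) (F 0 - d * (t - 0))"
      using t \<open>F t > 0\<close> by (intro step) auto
    ultimately show False by (simp add: max_def split: if_splits)
  qed
  then show "\<exists>T\<ge>0. \<forall>t\<ge>T. W t = 0" by (intro exI[of _ "max 0 (F 0 / d)"]) auto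
qed

section \<open>Matrices of the DHV network\<close>

lemma matrix_inv_right:
  fixes A :: "real ^ 'n ^ 'm"
  assumes "invertible A"
  shows "A ** matrix_inv A = mat 1"
  using assms unfolding invertible_def matrix_inv_def by (rule someI2_ex) simp

lemma exhaust_6:
  fixes x :: 6
  shows "x = 1 \<or> x = 2 \<or> x = 3 \<or> x = 4 \<or> x = 5 \<or> x = 6"
proof (induct x)
  case (of_int z)
  then have "0 \<le> z" and "z < 6" by simp_all
  then have "z = 0 \<or> z = 1 \<or> z = 2 \<or> z = 3 \<or> z = 4 \<or> z = 5" by arith
  then show ?case by auto
qed

lemma forall_6: "(\<forall>i::6. P i) \<longleftrightarrow> P 1 \<and> P 2 \<and> P 3 \<and> P 4 \<and> P 5 \<and> P 6"
  by (metis exhaust_6)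

lemma UNIV_6: "(UNIV :: 6 set) = {1, 2, 3, 4, 5, 6}"
  using exhaust_6 by auto

lemma sum_6: "sum f (UNIV::6 set) = f 1 + f 2 + f 3 + f 4 + f 5 + f 6"
  unfolding UNIV_6 by (simp add: ac_simps)

text \<open>Row 1 of the kernel equation reads \<open>v_1 = 0\<close>, as class 6 does not feed
  class 1, and row \<open>k\<close> reads \<open>v_k = v_(k-1)\<close>; substitution along the route
  gives a trivial kernel.\<close>

lemma invertible_dhv_routing: "invertible (mat 1 - transpose dhv_routing)"
proof -
  have "v = 0" if "(mat 1 - transpose dhv_routing) *v v = 0" for v :: "real ^ 6"
  proof -
    have "((mat 1 - transpose dhv_routing) *v v) $ k = 0" for k using that by simp
    then have "\<forall>k. ((mat 1 - transpose dhv_routing) *v v) $ k = 0" by simp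
    then show ?thesis
      by (simp add: forall_6 matrix_vector_mult_def sum_6 mat_def transpose_def dhv_routing_def
          vec_eq_iff)
  qed
  then show ?thesis
    by (simp add: invertible_left_inverse matrix_left_invertible_ker)
qed

text \<open>Entry \<open>(j, l)\<close> is the mean work that a class \<open>l\<close> job will bring to station \<open>j\<close>.\<close>

lemma dhv_workload_operator:
  "dhv_constituency ** service_matrix m ** visit_matrix dhv_routing =
    (\<chi> j l. if j = 1 then if l = 1 then m $ 1 + m $ 4 else if l \<in> {2, 3, 4} then m $ 4 else 0
       else if j = 2 then if l \<in> {1, 2} then m $ 2 + m $ 5 else if l \<in> {3, 4, 5} then m $ 5 else 0
       else if l \<in> {1, 2, 3} then m $ 3 + m $ 6 else m $ 6)"
  (is "?CM ** _ = ?H")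
proof -
  let ?A = "mat 1 - transpose dhv_routing :: real ^ 6 ^ 6"
  \<comment> \<open>The inverse is not computed: the claimed product is checked by multiplying it
    back by \<open>I - P'\<close>.\<close>
  have "?CM = ?H ** ?A"
    by (simp add: vec_eq_iff forall_3 forall_6 matrix_matrix_mult_def sum_6 mat_def transpose_def
        dhv_routing_def dhv_constituency_def service_matrix_def)
  then have "?CM ** visit_matrix dhv_routing = ?H ** (?A ** matrix_inv ?A)"
    by (simp add: visit_matrix_def matrix_mul_assoc)
  then show ?thesis
    by (simp add: matrix_inv_right invertible_dhv_routing)
qed

text \<open>The zero pattern of \<open>\<Delta>\<close> leaves two classes per column, and the
  normalization turns the total service time at a station into 1, so only \<open>m_4\<close>,
  \<open>m_5\<close>, \<open>m_6\<close> survive.\<close>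

lemma dhv_workload_matrix_eq:
  fixes m :: "real ^ 6" and \<Delta> :: "real ^ 3 ^ 6"
  assumes "m $ 1 + m $ 4 = 1" "m $ 2 + m $ 5 = 1" "m $ 3 + m $ 6 = 1" "dhv_ratio_matrix m \<Delta>"
  shows "dhv_workload_matrix m \<Delta> = vector [
    vector [\<Delta> $ 1 $ 1 + m $ 4 * \<Delta> $ 4 $ 1, m $ 4 * \<Delta> $ 2 $ 2, m $ 4 * \<Delta> $ 3 $ 3],
    vector [\<Delta> $ 1 $ 1 + m $ 5 * \<Delta> $ 4 $ 1, \<Delta> $ 2 $ 2 + m $ 5 * \<Delta> $ 5 $ 2, m $ 5 * \<Delta> $ 3 $ 3],
    vector [\<Delta> $ 1 $ 1 + m $ 6 * \<Delta> $ 4 $ 1, \<Delta> $ 2 $ 2 + m $ 6 * \<Delta> $ 5 $ 2, \<Delta> $ 3 $ 3 + m $ 6 * \<Delta> $ 6 $ 3]]"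
proof -
  have "\<forall>k j. dhv_constituency $ j $ k = 0 \<longrightarrow> \<Delta> $ k $ j = 0"
    using assms(4) by (simp add: ratio_matrix_def)
  then show ?thesis
    unfolding workload_matrix_def dhv_workload_operator using assms(1-3)
    by (simp add: vec_eq_iff forall_3 forall_6 matrix_matrix_mult_def sum_6 dhv_constituency_def)
qed

text \<open>On the diagonal, \<open>CM \<Delta> = I\<close> gives a combination of the two entries
  equal to 1, so they cannot both vanish.\<close>

lemma dhv_ratio_matrix_nonzero:
  fixes m :: "real ^ 6" and \<Delta> :: "real ^ 3 ^ 6"
  assumes "dhv_ratio_matrix m \<Delta>"
  shows "\<Delta> $ 1 $ 1 + \<Delta> $ 4 $ 1 > 0" "\<Delta> $ 2 $ 2 + \<Delta> $ 5 $ 2 > 0" "\<Delta> $ 3 $ 3 + \<Delta> $ 6 $ 3 > 0"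
proof -
  have nn: "\<Delta> $ k $ j \<ge> 0" for k j using assms by (simp add: ratio_matrix_def)
  have "dhv_constituency ** service_matrix m ** \<Delta> = mat 1"
    using assms by (simp add: ratio_matrix_def)
  then have "m $ 1 * \<Delta> $ 1 $ 1 + m $ 4 * \<Delta> $ 4 $ 1 = 1" "m $ 2 * \<Delta> $ 2 $ 2 + m $ 5 * \<Delta> $ 5 $ 2 = 1"
    "m $ 3 * \<Delta> $ 3 $ 3 + m $ 6 * \<Delta> $ 6 $ 3 = 1"
    by (simp_all add: vec_eq_iff forall_3 matrix_matrix_mult_def sum_6 mat_def
        dhv_constituency_def service_matrix_def)
  then show "\<Delta> $ 1 $ 1 + \<Delta> $ 4 $ 1 > 0" "\<Delta> $ 2 $ 2 + \<Delta> $ 5 $ 2 > 0" "\<Delta> $ 3 $ 3 + \<Delta> $ 6 $ 3 > 0"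
    using nn[of 1 1] nn[of 4 1] nn[of 2 2] nn[of 5 2] nn[of 3 3] nn[of 6 3]
    by (auto simp: add_nonneg_eq_0_iff less_le)
qed

section \<open>Lyapunov rows and invertibility of the workload matrix\<close>

text \<open>Serves both for pairs of entries of the ratio matrix and for the two coordinates of
  \<open>w\<close> left on a face.\<close>

lemma add_mult_strict_mono:
  fixes x y :: real
  assumes "p < q" "p' < q'" "x \<ge> 0" "y \<ge> 0" "x + y > 0"
  shows "p * x + p' * y < q * x + q' * y"
proof (cases "x > 0")
  case True
  then have "p * x < q * x" "p' * y \<le> q' * y" using assms by (auto intro: mult_right_mono)
  then show ?thesis by simp
next
  case False
  then have "x = 0" "y > 0" using assms by auto
  then show ?thesis using assms by simp
qed

lemma positive_vector_3:
  fixes w :: "real ^ 3"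
  assumes "w \<ge> 0" "w \<noteq> 0"
  shows "w $ 1 \<ge> 0" "w $ 2 \<ge> 0" "w $ 3 \<ge> 0" "w $ 1 + w $ 2 + w $ 3 > 0"
  using assms by (auto simp: less_eq_vec_def vec_eq_iff forall_3)

text \<open>
  Here \<open>a\<close>, \<open>b\<close>, \<open>c\<close> stand for \<open>m\<^sub>4\<close>, \<open>m\<^sub>5\<close>, \<open>m\<^sub>6\<close>, and \<open>d\<^sub>k\<close> is the only possibly nonzero entry
  in row \<open>k\<close> of the ratio matrix.
\<close>

locale dhv_workload =
  fixes a b c d\<^sub>1 d\<^sub>2 d\<^sub>3 d\<^sub>4 d\<^sub>5 d\<^sub>6 :: real and G :: "real ^ 3 ^ 3"
  assumes a: "0 < a" "a < 1" and b: "0 < b" "b < 1" and c: "0 < c" "c < 1"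
    and nn: "d\<^sub>1 \<ge> 0" "d\<^sub>2 \<ge> 0" "d\<^sub>3 \<ge> 0" "d\<^sub>4 \<ge> 0" "d\<^sub>5 \<ge> 0" "d\<^sub>6 \<ge> 0"
    and pos: "d\<^sub>1 + d\<^sub>4 > 0" "d\<^sub>2 + d\<^sub>5 > 0" "d\<^sub>3 + d\<^sub>6 > 0"
    and G: "G = vector [
      vector [d\<^sub>1 + a * d\<^sub>4, a * d\<^sub>2, a * d\<^sub>3],
      vector [d\<^sub>1 + b * d\<^sub>4, d\<^sub>2 + b * d\<^sub>5, b * d\<^sub>3],
      vector [d\<^sub>1 + c * d\<^sub>4, d\<^sub>2 + c * d\<^sub>5, d\<^sub>3 + c * d\<^sub>6]]"
begin

lemma G_mult:
  "(G *v w) $ 1 = (d\<^sub>1 + a * d\<^sub>4) * w $ 1 + a * d\<^sub>2 * w $ 2 + a * d\<^sub>3 * w $ 3"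
  "(G *v w) $ 2 = (d\<^sub>1 + b * d\<^sub>4) * w $ 1 + (d\<^sub>2 + b * d\<^sub>5) * w $ 2 + b * d\<^sub>3 * w $ 3"
  "(G *v w) $ 3 = (d\<^sub>1 + c * d\<^sub>4) * w $ 1 + (d\<^sub>2 + c * d\<^sub>5) * w $ 2 + (d\<^sub>3 + c * d\<^sub>6) * w $ 3"
  by (simp_all add: G matrix_vector_mult_def sum_3)

text \<open>The strict inequalities between scaled entries of \<open>G\<close> below have
  differences of this form, so they reduce to the signs of two explicit coefficients.\<close>

lemma combination_pos:
  assumes "p > 0" "q > 0"
  shows "p * d\<^sub>1 + q * d\<^sub>4 > 0" "p * d\<^sub>2 + q * d\<^sub>5 > 0" "p * d\<^sub>3 + q * d\<^sub>6 > 0"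
proof -
  have "p * x + q * y > 0" if "x \<ge> 0" "y \<ge> 0" "x + y > 0" for x y
    using add_mult_strict_mono[of 0 p 0 q x y] assms that by simp
  then show "p * d\<^sub>1 + q * d\<^sub>4 > 0" "p * d\<^sub>2 + q * d\<^sub>5 > 0" "p * d\<^sub>3 + q * d\<^sub>6 > 0"
    using nn pos by blast+
qed

text \<open>The last row of \<open>G\<close> is positive, as every job still has to pass class
  6.\<close>

lemma G_mult_3_pos:
  assumes "w \<ge> 0" "w \<noteq> 0"
  shows "(G *v w) $ 3 > 0"
proof -
  note w = positive_vector_3[OF assms]
  note g = combination_pos[of 1 c, simplified, OF c(1)]
  have "(d\<^sub>1 + c * d\<^sub>4) * w $ 1 \<ge> 0" "(d\<^sub>2 + c * d\<^sub>5) * w $ 2 \<ge> 0" "(d\<^sub>3 + c * d\<^sub>6) * w $ 3 \<ge> 0"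
    using g w by simp_all
  moreover have "w $ 1 > 0 \<or> w $ 2 > 0 \<or> w $ 3 > 0" using w by linarith
  then have "(d\<^sub>1 + c * d\<^sub>4) * w $ 1 > 0 \<or> (d\<^sub>2 + c * d\<^sub>5) * w $ 2 > 0 \<or> (d\<^sub>3 + c * d\<^sub>6) * w $ 3 > 0"
    using g by auto
  ultimately show ?thesis unfolding G_mult by linarith
qed

text \<open>On \<open>w_1 = 0\<close> row 3 beats row 1, on \<open>w_2 = 0\<close> row 1 or row 3
  beats row 2, and on \<open>w_3 = 0\<close> row 2 beats row 3. This follows from
  \<open>max b c < k\<^sub>2 * b < k\<^sub>1 * a < 1\<close> and
  \<open>1 < k\<^sub>2 < k\<^sub>1\<close>; the assumption \<open>a \<le> b\<close> enters through
  \<open>k\<^sub>2 < k\<^sub>1\<close>.\<close>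

lemma diagonal_lyapunov:
  assumes ab: "a \<le> b"
  obtains L :: "3 \<Rightarrow> real ^ 3"
  where "\<And>i. (\<Sum>j\<in>UNIV. L i $ j) > 0"
    and "\<And>w. \<lbrakk>w \<ge> 0; w \<noteq> 0\<rbrakk> \<Longrightarrow> \<exists>i. L i \<bullet> (G *v w) > 0"
    and "\<And>w i j. \<lbrakk>w \<ge> 0; w \<noteq> 0; w $ j = 0; L i $ j > 0\<rbrakk>
      \<Longrightarrow> \<exists>l. L i \<bullet> (G *v w) < L l \<bullet> (G *v w)"
proof
  \<comment> \<open>\<open>k\<^sub>2 b\<close> is the midpoint of \<open>max b c\<close> and \<open>1\<close>, and \<open>k\<^sub>1 a\<close> that of \<open>k\<^sub>2 b\<close> and \<open>1\<close>.\<close>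
  define k\<^sub>2 where "k\<^sub>2 = (max b c + 1) / (2 * b)"
  define k\<^sub>1 where "k\<^sub>1 = (k\<^sub>2 * b + 1) / (2 * a)"
  define L :: "3 \<Rightarrow> real ^ 3" where
    "L = (\<lambda>i. if i = 1 then vector [k\<^sub>1, 0, 0] else if i = 2 then vector [0, k\<^sub>2, 0] else vector [0, 0, 1])"
  have k2b: "k\<^sub>2 * b = (max b c + 1) / 2" using b by (simp add: k\<^sub>2_def)
  have k2: "b < k\<^sub>2 * b" "c < k\<^sub>2 * b" "k\<^sub>2 * b < 1" unfolding k2b using b c by (auto simp: max_def)
  have "k\<^sub>2 > 1" using k2(1) b by simp
  have k1a: "k\<^sub>1 * a = (k\<^sub>2 * b + 1) / 2" using a by (simp add: k\<^sub>1_def)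
  then have k1: "k\<^sub>2 * b < k\<^sub>1 * a" "k\<^sub>1 * a < 1" using k2 by auto
  have "k\<^sub>2 * a \<le> k\<^sub>2 * b" using ab \<open>k\<^sub>2 > 1\<close> by simp
  then have "k\<^sub>2 < k\<^sub>1" using k1(1) a(1) by (intro mult_right_less_imp_less[of k\<^sub>2 a k\<^sub>1]) linarith+
  show "(\<Sum>j\<in>UNIV. L i $ j) > 0" for i
    using \<open>k\<^sub>2 > 1\<close> \<open>k\<^sub>2 < k\<^sub>1\<close> by (auto simp: L_def sum_3)
  have LU: "L 1 \<bullet> u = k\<^sub>1 * u $ 1" "L 2 \<bullet> u = k\<^sub>2 * u $ 2" "L 3 \<bullet> u = u $ 3" for u
    by (simp_all add: L_def inner_vec_def sum_3)
  show "\<exists>i. L i \<bullet> (G *v w) > 0" if "w \<ge> 0" "w \<noteq> 0" for w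
    using G_mult_3_pos[OF that] LU(3) by metis
  show "\<exists>l. L i \<bullet> (G *v w) < L l \<bullet> (G *v w)"
    if w: "w \<ge> 0" "w \<noteq> 0" and j: "w $ j = 0" "L i $ j > 0" for w i j
  proof -
    note nw = positive_vector_3[OF w]
    have "i = j"
      using j(2) exhaust_3[of i] exhaust_3[of j] by (auto simp: L_def)
    \<comment> \<open>If \<open>w_1 = w_2 = 0\<close> and \<open>d\<^sub>3 = 0\<close>, rows 1 and 2
      both give 0, so row 3 has to win there.\<close>
    consider "j = 1" | "j = 2" "w $ 1 = 0" | "j = 2" "w $ 1 > 0" | "j = 3"
      using exhaust_3[of j] nw(1) by fastforce
    then show ?thesis
    proof cases
      case 1
      have "k\<^sub>1 * (a * d\<^sub>2) < d\<^sub>2 + c * d\<^sub>5" "k\<^sub>1 * (a * d\<^sub>3) < d\<^sub>3 + c * d\<^sub>6"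
        using combination_pos[of "1 - k\<^sub>1 * a" c] k1 c by (simp_all add: algebra_simps)
      then have "L 1 \<bullet> (G *v w) < L 3 \<bullet> (G *v w)"
        using add_mult_strict_mono[of "k\<^sub>1 * (a * d\<^sub>2)" "d\<^sub>2 + c * d\<^sub>5" "k\<^sub>1 * (a * d\<^sub>3)" "d\<^sub>3 + c * d\<^sub>6" "w $ 2" "w $ 3"]
          nw j(1) 1 by (simp add: LU G_mult algebra_simps)
      then show ?thesis using \<open>i = j\<close> 1 by blast
    next
      case 2
      have "k\<^sub>2 * (b * d\<^sub>3) < d\<^sub>3 + c * d\<^sub>6"
        using combination_pos(3)[of "1 - k\<^sub>2 * b" c] k2 c by (simp add: algebra_simps)
      then have "L 2 \<bullet> (G *v w) < L 3 \<bullet> (G *v w)"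
        using mult_strict_right_mono[of "k\<^sub>2 * (b * d\<^sub>3)" "d\<^sub>3 + c * d\<^sub>6" "w $ 3"]
          nw j(1) 2 by (simp add: LU G_mult algebra_simps)
      then show ?thesis using \<open>i = j\<close> 2 by blast
    next
      case 3
      have "k\<^sub>2 * (d\<^sub>1 + b * d\<^sub>4) < k\<^sub>1 * (d\<^sub>1 + a * d\<^sub>4)"
        using combination_pos(1)[of "k\<^sub>1 - k\<^sub>2" "k\<^sub>1 * a - k\<^sub>2 * b"] k1 \<open>k\<^sub>2 < k\<^sub>1\<close> by (simp add: algebra_simps)
      moreover have "k\<^sub>2 * b * (d\<^sub>3 * w $ 3) \<le> k\<^sub>1 * a * (d\<^sub>3 * w $ 3)"
        using k1 nn nw by (intro mult_right_mono) auto
      ultimately have "L 2 \<bullet> (G *v w) < L 1 \<bullet> (G *v w)"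
        using mult_strict_right_mono[of "k\<^sub>2 * (d\<^sub>1 + b * d\<^sub>4)" "k\<^sub>1 * (d\<^sub>1 + a * d\<^sub>4)" "w $ 1"]
          j(1) 3 by (simp add: LU G_mult algebra_simps)
      then show ?thesis using \<open>i = j\<close> 3 by blast
    next
      case 4
      have "d\<^sub>1 + c * d\<^sub>4 < k\<^sub>2 * (d\<^sub>1 + b * d\<^sub>4)" "d\<^sub>2 + c * d\<^sub>5 < k\<^sub>2 * (d\<^sub>2 + b * d\<^sub>5)"
        using combination_pos[of "k\<^sub>2 - 1" "k\<^sub>2 * b - c"] k2 \<open>k\<^sub>2 > 1\<close> by (simp_all add: algebra_simps)
      then have "L 3 \<bullet> (G *v w) < L 2 \<bullet> (G *v w)"
        using add_mult_strict_mono[of "d\<^sub>1 + c * d\<^sub>4" "k\<^sub>2 * (d\<^sub>1 + b * d\<^sub>4)" "d\<^sub>2 + c * d\<^sub>5" "k\<^sub>2 * (d\<^sub>2 + b * d\<^sub>5)" "w $ 1" "w $ 2"]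
          nw j(1) 4 by (simp add: LU G_mult algebra_simps)
      then show ?thesis using \<open>i = j\<close> 4 by blast
    qed
  qed
qed

text \<open>The term \<open>U_2 - s U_1\<close> is nonpositive on \<open>w_2 = 0\<close> and equals
  \<open>r w_2\<close> with \<open>r > 0\<close> on \<open>w_3 = 0\<close>, so its weight
  \<open>p\<close> can be as large as the third face demands without harm to the second. As
  \<open>s \<le> 1\<close>, the second row keeps a coordinate sum of at least 1/2; its first entry
  is negative, so on \<open>w_1 = 0\<close> only row 1 must be beaten.\<close>

lemma triangular_lyapunov:
  assumes ba: "b < a"
  obtains L :: "3 \<Rightarrow> real ^ 3"
  where "\<And>i. (\<Sum>j\<in>UNIV. L i $ j) > 0"
    and "\<And>w. \<lbrakk>w \<ge> 0; w \<noteq> 0\<rbrakk> \<Longrightarrow> \<exists>i. L i \<bullet> (G *v w) > 0"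
    and "\<And>w i j. \<lbrakk>w \<ge> 0; w \<noteq> 0; w $ j = 0; L i $ j > 0\<rbrakk>
      \<Longrightarrow> \<exists>l. L i \<bullet> (G *v w) < L l \<bullet> (G *v w)"
proof
  define g\<^sub>1 where "g\<^sub>1 = d\<^sub>1 + a * d\<^sub>4"
  define g\<^sub>2 where "g\<^sub>2 = d\<^sub>1 + b * d\<^sub>4"
  define g\<^sub>3 where "g\<^sub>3 = d\<^sub>1 + c * d\<^sub>4"
  define h where "h = d\<^sub>2 + c * d\<^sub>5"
  define s where "s = g\<^sub>2 / g\<^sub>1"
  \<comment> \<open>A midpoint: \<open>a < k\<close> lets row 3 beat row 1 on
    \<open>w_1 = 0\<close>, and \<open>k < g\<^sub>1 / g\<^sub>3\<close> lets row 1 beat row 3 along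
    the first axis. The interval is nonempty because
    \<open>a * g\<^sub>3 < g\<^sub>1\<close>.\<close>
  define k where "k = (a + g\<^sub>1 / g\<^sub>3) / 2"
  define r where "r = d\<^sub>2 + b * d\<^sub>5 - s * (a * d\<^sub>2)"
  define e where "e = g\<^sub>1 - k * g\<^sub>3"
  \<comment> \<open>On \<open>w\<^sub>3 = 0\<close>, if \<open>U\<^sub>1\<close> does not exceed \<open>k U\<^sub>3\<close>, then \<open>e k U\<^sub>3 \<le> k h g\<^sub>1 w\<^sub>2\<close>, whereas
    \<open>U\<^sub>2 - s U\<^sub>1 = r w\<^sub>2\<close>; this \<open>p\<close> makes the second row win.\<close>
  define p where "p = (k * h * g\<^sub>1 + 1) / (r * e)"
  define L :: "3 \<Rightarrow> real ^ 3" where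
    "L = (\<lambda>i. if i = 1 then vector [1, 0, 0] else if i = 2 then vector [- p * s, 1 / 2 + p, 0]
      else vector [0, 0, k])"
  have g: "g\<^sub>1 > 0" "g\<^sub>2 > 0" "g\<^sub>3 > 0" "h > 0"
    using combination_pos[of 1 a] combination_pos[of 1 b] combination_pos[of 1 c] a b c
    by (simp_all add: g\<^sub>1_def g\<^sub>2_def g\<^sub>3_def h_def)
  have "b * d\<^sub>4 \<le> a * d\<^sub>4" using ba nn by (intro mult_right_mono) auto
  then have "g\<^sub>2 \<le> g\<^sub>1" by (simp add: g\<^sub>1_def g\<^sub>2_def)
  then have s: "0 < s" "s \<le> 1" and sg: "s * g\<^sub>1 = g\<^sub>2" using g by (simp_all add: s_def)
  \<comment> \<open>The \<open>d\<^sub>4\<close> terms cancel, and the difference of the two sides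
    is \<open>(a - b) * d\<^sub>1\<close>.\<close>
  have "b * g\<^sub>1 \<le> a * g\<^sub>2"
    using nn ba by (auto simp: g\<^sub>1_def g\<^sub>2_def algebra_simps intro: mult_right_mono)
  then have sa: "b \<le> s * a" using g by (simp add: s_def field_simps)
  have "a * g\<^sub>3 < g\<^sub>1"
    using combination_pos(1)[of "1 - a" "a * (1 - c)"] a c by (simp add: g\<^sub>1_def g\<^sub>3_def algebra_simps)
  then have "a < g\<^sub>1 / g\<^sub>3" using g by (simp add: field_simps)
  moreover have "2 * k = a + g\<^sub>1 / g\<^sub>3" by (simp add: k_def)
  ultimately have k: "a < k" "k < g\<^sub>1 / g\<^sub>3" by linarith+
  then have "k > 0" "e > 0" using g a by (simp_all add: e_def field_simps)
  have "s * a \<le> 1 * a" using s a by (intro mult_right_mono) auto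
  then have "s * a < 1" using a by linarith
  then have "r > 0"
    using combination_pos(2)[of "1 - s * a" b] b by (simp add: r_def algebra_simps)
  have "p > 0" and pre: "p * r * e = k * h * g\<^sub>1 + 1"
    using \<open>r > 0\<close> \<open>e > 0\<close> \<open>k > 0\<close> g by (simp_all add: p_def add_nonneg_pos)
  have "p * s \<le> p * 1" using \<open>p > 0\<close> s by (intro mult_left_mono) auto
  show "(\<Sum>j\<in>UNIV. L i $ j) > 0" for i
    using \<open>k > 0\<close> \<open>p * s \<le> p * 1\<close> by (auto simp: L_def sum_3)
  have LU: "L 1 \<bullet> u = u $ 1" "L 2 \<bullet> u = u $ 2 / 2 + p * (u $ 2 - s * u $ 1)" "L 3 \<bullet> u = k * u $ 3" for u
    by (simp_all add: L_def inner_vec_def sum_3 algebra_simps)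
  show "\<exists>i. L i \<bullet> (G *v w) > 0" if "w \<ge> 0" "w \<noteq> 0" for w
    using G_mult_3_pos[OF that] LU(3) \<open>k > 0\<close> by (metis mult_pos_pos)
  show "\<exists>l. L i \<bullet> (G *v w) < L l \<bullet> (G *v w)"
    if w: "w \<ge> 0" "w \<noteq> 0" and j: "w $ j = 0" "L i $ j > 0" for w i j
  proof -
    define U where "U = G *v w"
    note nw = positive_vector_3[OF w]
    note U = G_mult[of w, folded U_def g\<^sub>1_def g\<^sub>2_def g\<^sub>3_def h_def]
    have U3: "U $ 3 > 0" using G_mult_3_pos[OF w] by (simp add: U_def)
    have "p * s > 0" using \<open>p > 0\<close> s by simp
    then have "i = j"
      using j(2) exhaust_3[of i] exhaust_3[of j] by (auto simp: L_def)
    have "\<exists>l. L j \<bullet> U < L l \<bullet> U"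
    proof -
      consider "j = 1" | "j = 2" | "j = 3"
        using exhaust_3[of j] by blast
      then show ?thesis
      proof cases
        case 1
        have "a * d\<^sub>2 < k * h" "a * d\<^sub>3 < k * (d\<^sub>3 + c * d\<^sub>6)"
          using combination_pos[of "k - a" "k * c"] k \<open>k > 0\<close> c by (simp_all add: h_def algebra_simps)
        then have "L 1 \<bullet> U < L 3 \<bullet> U"
          using add_mult_strict_mono[of "a * d\<^sub>2" "k * h" "a * d\<^sub>3" "k * (d\<^sub>3 + c * d\<^sub>6)" "w $ 2" "w $ 3"]
            nw j(1) 1 by (simp add: LU U algebra_simps)
        then show ?thesis using 1 by blast
      next
        case 2
        have U12: "U $ 1 = g\<^sub>1 * w $ 1 + a * (d\<^sub>3 * w $ 3)" "U $ 2 = g\<^sub>2 * w $ 1 + b * (d\<^sub>3 * w $ 3)"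
          using j(1) 2 by (simp_all add: U)
        have x: "d\<^sub>3 * w $ 3 \<ge> 0" using nn nw by simp
        have "U $ 2 - s * U $ 1 = (b - s * a) * (d\<^sub>3 * w $ 3)"
          unfolding U12 sg[symmetric] by (simp add: algebra_simps)
        also have "\<dots> \<le> 0" using sa x by (intro mult_nonpos_nonneg) auto
        finally have "p * (U $ 2 - s * U $ 1) \<le> 0" using \<open>p > 0\<close> by (simp add: mult_le_0_iff)
        \<comment> \<open>Row 2 is thus at most \<open>U_1 / 2\<close>: it loses to row 1 if
          \<open>U_1 > 0\<close>, and otherwise it is nonpositive and loses to row 3. This is the
          purpose of the factor 1/2.\<close>
        then have "L 2 \<bullet> U \<le> U $ 2 / 2" by (simp add: LU)
        moreover have "U $ 2 \<le> U $ 1"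
          unfolding U12 using \<open>g\<^sub>2 \<le> g\<^sub>1\<close> ba x nw by (intro add_mono mult_right_mono) auto
        moreover have "U $ 1 \<ge> 0" unfolding U12 using g a x nw by simp
        moreover have "k * U $ 3 > 0" using \<open>k > 0\<close> U3 by simp
        ultimately have "L 2 \<bullet> U < L 1 \<bullet> U \<or> L 2 \<bullet> U < L 3 \<bullet> U" unfolding LU(1,3) by linarith
        then show ?thesis using 2 by blast
      next
        case 3
        show ?thesis
        proof (cases "k * U $ 3 < U $ 1")
          case True
          then have "L 3 \<bullet> U < L 1 \<bullet> U" by (simp add: LU)
          then show ?thesis using 3 by blast
        next
          case False
          have U13: "U $ 1 = g\<^sub>1 * w $ 1 + a * d\<^sub>2 * w $ 2" "U $ 3 = g\<^sub>3 * w $ 1 + h * w $ 2"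
            and U2: "U $ 2 - s * U $ 1 = r * w $ 2" "U $ 2 \<ge> 0"
            using j(1) 3 sg nw g b nn by (simp_all add: U r_def algebra_simps)
          have "a * d\<^sub>2 * w $ 2 \<ge> 0" using a nn nw by simp
          then have ex: "e * w $ 1 \<le> k * h * w $ 2"
            using False unfolding U13 by (simp add: e_def algebra_simps)
          have y: "w $ 2 > 0"
          proof (rule ccontr)
            assume "\<not> w $ 2 > 0"
            then have "w $ 2 = 0" "w $ 1 > 0" using nw j(1) 3 by auto
            then show False using ex mult_pos_pos[OF \<open>e > 0\<close>, of "w $ 1"] by simp
          qed
          \<comment> \<open>After multiplication by \<open>e\<close>, the bound \<open>ex\<close>
            trades \<open>w $ 1\<close> for \<open>w $ 2\<close>; the coefficients then collapse by
            \<open>k * g\<^sub>3 + e = g\<^sub>1\<close>.\<close>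
          have "e * (k * U $ 3) = k * g\<^sub>3 * (e * w $ 1) + k * h * e * w $ 2"
            by (simp add: U13 algebra_simps)
          also have "\<dots> \<le> k * g\<^sub>3 * (k * h * w $ 2) + k * h * e * w $ 2"
            using ex \<open>k > 0\<close> g by (intro add_right_mono mult_left_mono) auto
          also have "\<dots> = k * h * g\<^sub>1 * w $ 2" by (simp add: e_def algebra_simps)
          also have "\<dots> < p * r * e * w $ 2"
            unfolding pre using y by (intro mult_strict_right_mono) simp_all
          finally have "e * (k * U $ 3) < e * (p * (r * w $ 2))" by (simp add: algebra_simps)
          then have "k * U $ 3 < p * (r * w $ 2)" using \<open>e > 0\<close> by simp
          then have "L 3 \<bullet> U < L 2 \<bullet> U" using U2 by (simp add: LU)
          then show ?thesis using 3 by blast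
        qed
      qed
    qed
    then show ?thesis using \<open>i = j\<close> by (simp add: U_def)
  qed
qed

text \<open>Column \<open>k\<close> of \<open>G\<close> is linear in its two ratio entries, so the
  determinant expands into eight products. All eight coefficients are positive, and the nested form
  lets \<open>combination_pos\<close> apply column by column.\<close>

lemma invertible_G: "invertible G"
proof -
  have "det G =
      (((1 - a) * (1 - b) * d\<^sub>3 + c * (1 - a) * d\<^sub>6) * d\<^sub>2 +
       ((a * c * (1 - b) + b * (1 - a) * (1 - c)) * d\<^sub>3 + b * c * d\<^sub>6) * d\<^sub>5) * d\<^sub>1 +
      ((a * (1 - b) * (1 - c) * d\<^sub>3 + a * c * (1 - b) * d\<^sub>6) * d\<^sub>2 +
       (a * b * (1 - c) * d\<^sub>3 + a * b * c * d\<^sub>6) * d\<^sub>5) * d\<^sub>4"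
    by (simp add: G det_3 algebra_simps)
  also have "\<dots> > 0"
    using a b c by (intro combination_pos add_pos_pos mult_pos_pos) simp_all
  finally show ?thesis by (simp add: invertible_det_nz)
qed

end

section \<open>Stability for the DHV network\<close>

theorem corollary1:
  fixes m :: "real ^ 6" and \<alpha>\<^sub>1 :: real and \<Delta> :: "real ^ 3 ^ 6"
  assumes "\<And>k. m $ k > 0"
    and "\<alpha>\<^sub>1 \<ge> 0"
    and "balanced (dhv_load m \<alpha>\<^sub>1)"
    and "m $ 1 + m $ 4 = 1" and "m $ 2 + m $ 5 = 1" and "m $ 3 + m $ 6 = 1"
    and "dhv_load m \<alpha>\<^sub>1 $ 1 = \<alpha>\<^sub>1" and "dhv_load m \<alpha>\<^sub>1 $ 2 = \<alpha>\<^sub>1" and "dhv_load m \<alpha>\<^sub>1 $ 3 = \<alpha>\<^sub>1"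
    and "\<alpha>\<^sub>1 < 1"
    and "dhv_ratio_matrix m \<Delta>"
  shows "invertible (dhv_workload_matrix m \<Delta>) \<and>
         skorohod_stable (dhv_reflection m \<Delta>) (dhv_drift m \<alpha>\<^sub>1 \<Delta>)"
proof -
  define a b c where "a = m $ 4" and "b = m $ 5" and "c = m $ 6"
  let ?G = "dhv_workload_matrix m \<Delta>" and ?R = "dhv_reflection m \<Delta>"
  have "\<Delta> $ k $ j \<ge> 0" for k j using assms(11) by (simp add: ratio_matrix_def)
  then interpret dhv_workload a b c "\<Delta> $ 1 $ 1" "\<Delta> $ 2 $ 2" "\<Delta> $ 3 $ 3" "\<Delta> $ 4 $ 1" "\<Delta> $ 5 $ 2" "\<Delta> $ 6 $ 3" ?G
    using assms(1)[of 1] assms(1)[of 2] assms(1)[of 3] assms(1)[of 4] assms(1)[of 5] assms(1)[of 6]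
      assms(4-6) dhv_ratio_matrix_nonzero[OF assms(11)]
    by unfold_locales (auto simp: a_def b_def c_def dhv_workload_matrix_eq[OF assms(4-6,11)])
  obtain L :: "3 \<Rightarrow> real ^ 3"
    where row: "\<And>i. (\<Sum>j\<in>UNIV. L i $ j) > 0"
      and pos: "\<And>w. \<lbrakk>w \<ge> 0; w \<noteq> 0\<rbrakk> \<Longrightarrow> \<exists>i. L i \<bullet> (?G *v w) > 0"
      and face: "\<And>w i j. \<lbrakk>w \<ge> 0; w \<noteq> 0; w $ j = 0; L i $ j > 0\<rbrakk>
        \<Longrightarrow> \<exists>l. L i \<bullet> (?G *v w) < L l \<bullet> (?G *v w)"
  proof (cases "a \<le> b")
    case True
    then show ?thesis by (rule diagonal_lyapunov) (rule that)
  next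
    case False
    then have "b < a" by simp
    then show ?thesis by (rule triangular_lyapunov) (rule that)
  qed
  have GR: "?G ** ?R = mat 1"
    unfolding reflection_matrix_def by (rule matrix_inv_right[OF invertible_G])
  \<comment> \<open>Row \<open>i\<close> drifts at rate \<open>\<alpha>\<^sub>1 - 1\<close> times
    its coordinate sum, so the least sum yields one rate for all rows.\<close>
  define \<sigma> where "\<sigma> = Min (range (\<lambda>i. \<Sum>j\<in>UNIV. L i $ j))"
  have "\<sigma> > 0" using row by (simp add: \<sigma>_def)
  have "dhv_load m \<alpha>\<^sub>1 - (\<chi> j. 1) = (\<chi> j. \<alpha>\<^sub>1 - 1)"
    using assms(7-9) by (simp add: vec_eq_iff forall_3)
  then have G\<theta>: "?G *v dhv_drift m \<alpha>\<^sub>1 \<Delta> = (\<chi> j. \<alpha>\<^sub>1 - 1)"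
    by (simp add: drift_vector_def matrix_vector_mul_assoc GR)
  have drift: "L i \<bullet> (?G *v dhv_drift m \<alpha>\<^sub>1 \<Delta>) \<le> - ((1 - \<alpha>\<^sub>1) * \<sigma>)" for i
  proof -
    have "\<sigma> \<le> (\<Sum>j\<in>UNIV. L i $ j)" by (simp add: \<sigma>_def)
    then have "(1 - \<alpha>\<^sub>1) * \<sigma> \<le> (1 - \<alpha>\<^sub>1) * (\<Sum>j\<in>UNIV. L i $ j)"
      using assms(10) by (intro mult_left_mono) auto
    then show ?thesis
      by (simp add: G\<theta> inner_vec_def sum_3 algebra_simps)
  qed
  have "(1 - \<alpha>\<^sub>1) * \<sigma> > 0" using \<open>\<sigma> > 0\<close> assms(10) by simp
  from skorohod_stable_if_piecewise_linear_lyapunov[OF GR this drift pos face] invertible_G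
  show ?thesis by simp
qed

end
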